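(* Let $k\ge1$ and $\Gamma(k)=A_1\otimes\cdots\otimes A_k$ with $A_1,\dots,A_k\in\mathcal{Y}$. The tropical factor rank of each $C_\nu S_\nu^{k\,(\mathrm{mod}\,\gamma_\nu)}R_\nu[\Gamma(k)]$ is no more than $\gamma_\nu$, for $\nu=1,\dots,m$, and the tropical factor rank of $CS^{k\,(\mathrm{mod}\,\gamma)}R[\Gamma(k)]$ is no more than $\sum_{\nu=1}^m\gamma_\nu$.
   Context: **Tropical algebra and digraphs.** $\mathbb{R}_{\max}=\mathbb{R}\cup\{-\infty\}$, $a\oplus b=\max(a,b)$, $a\otimes b=a+b$, $\varepsilon=-\infty$; $(A\otimes B)_{i,j}=\max_l(a_{i,l}+b_{l,j})$; matrix powers are tropical and $A^0=I$ ($0$ on the diagonal, $\varepsilon$ elsewhere). The tropical factor rank of $A\in\mathbb{R}_{\max}^{n\times p}$ is the smallest $r\in\mathbb{N}$ such that $A=U\otimes L$ with $U\in\mathbb{R}_{\max}^{n\times r}$, $L\in\mathbb{R}_{\max}^{r\times p}$. For an $n\times n$ matrix $A$, $\mathcal{D}(A)$ has nodes $1,\dots,n$ and an edge $(i,j)$ of weight $a_{i,j}$ iff $a_{i,j}\ne\varepsilon$. $A$ is irreducible if $\mathcal{D}(A)$ is strongly connected. $\lambda(A)$ is the maximal mean weight (weight/length) of cycles of $\mathcal{D}(A)$. The critical digraph $\mathbf{C}(A)$ consists of all nodes and edges lying on cycles of mean weight $\lambda(A)$. The cyclicity of a strongly connected digraph is the gcd of its cycle lengths; that of a disjoint union of strongly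 connected components is the lcm of their cyclicities. **Standing assumptions.** $\mathcal{X}$ is a nonempty, possibly infinite, set of $n\times n$ matrices over $\mathbb{R}_{\max}$, each irreducible with finite $\lambda$; $\mathcal{Y}=\{A-\lambda(A): A\in\mathcal{X}\}$ ($\lambda(A)$ subtracted from each entry). $A^{\sup}$, $A^{\inf}$ are the entrywise supremum and infimum of the matrices in $\mathcal{Y}$; $A^{\sup}$ has all entries in $\mathbb{R}_{\max}$. All matrices of $\mathcal{X}$ and $A^{\sup}$ have the same digraph $\mathcal{D}(\mathcal{X})=(N,E)$ (as unweighted digraph) and the same critical digraph $\mathbf{C}(\mathcal{X})=(\mathcal{N}_c,\mathcal{E}_c)$, whose strongly connected components are $\mathbf{C}_1,\dots,\mathbf{C}_m$. For $(i,j)\in E$, $(A^{\inf})_{i,j}\neq-\infty$. For all $A\in\mathcal{Y}$: $A_{i,j}=(A^{\sup})_{i,j}=0$ for $(i,j)\in\mathcal{E}_c$, and $A_{i,j}\le0$, $(A^{\sup})_{i,j}\le0$ for $(i,j)\notin\mathcal{E}_c$. **CSR.** Here $k\,(\mathrm{mod}\,g)\in\{0,\dots,g-1\}$. $S$ is the $n\times n$ matrix with $S_{i,j}=0$ if $(i,j)\in\mathcal{E}_c$ and $\varepsilon$ otherwise; $\gamma$ is the cyclicity of $\mathbf{C}(\mathcal{X})$; $T(S)$ is the least $T$ with $S^{l+\gamma}=S^l$ for all $l\ge T$; $t$ is any integer with $t\gamma\ge T(S)$; $C=\Gamma(k)\otimes S^{(t+1)\gamma-k(\mathrm{mod}\,\gamma)}$,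 $R=S^{(t+1)\gamma-k(\mathrm{mod}\,\gamma)}\otimes\Gamma(k)$; $CS^{k(\mathrm{mod}\,\gamma)}R[\Gamma(k)]=C\otimes S^{k(\mathrm{mod}\,\gamma)}\otimes R$. For each $\nu$, $S_\nu$, $\gamma_\nu$, $T(S_\nu)$, $t_\nu$, $C_\nu$, $R_\nu$ and $C_\nu S_\nu^{k(\mathrm{mod}\,\gamma_\nu)}R_\nu[\Gamma(k)]=C_\nu\otimes S_\nu^{k(\mathrm{mod}\,\gamma_\nu)}\otimes R_\nu$ are defined in the same way with the component $\mathbf{C}_\nu$ in place of $\mathbf{C}(\mathcal{X})$: $(S_\nu)_{i,j}=0$ if $(i,j)$ is an edge of $\mathbf{C}_\nu$ and $\varepsilon$ otherwise, $\gamma_\nu$ is the cyclicity of $\mathbf{C}_\nu$, $t_\nu\gamma_\nu\ge T(S_\nu)$, $C_\nu=\Gamma(k)\otimes S_\nu^{(t_\nu+1)\gamma_\nu-k(\mathrm{mod}\,\gamma_\nu)}$, $R_\nu=S_\nu^{(t_\nu+1)\gamma_\nu-k(\mathrm{mod}\,\gamma_\nu)}\otimes\Gamma(k)$. *)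

theory Defs
  imports
    "HOL-Library.Extended_Real"
    "Jordan_Normal_Form.Matrix"
    "Graph_Theory.Digraph_Component"
begin

section \<open>The max-plus semiring\<close>

text \<open>The extended reals without \<open>+\<infinity>\<close>. As a semiring, addition is the maximum and
  multiplication is the usual addition; hence the semiring constant \<open>0\<close> is \<open>-\<infinity>\<close> and the
  semiring constant \<open>1\<close> is the real number zero. With this instance the matrix product, the matrix
  powers and the identity matrix of the matrix library are the max-plus ones.\<close>

typedef rmax = "{x :: ereal. x \<noteq> \<infinity>}"
  morphisms rval Rmax
  by (rule exI[of _ 0]) simp

setup_lifting type_definition_rmax

instantiation rmax :: comm_semiring_1
begin

lift_definition zero_rmax :: rmax is "-\<infinity>" by simp
lift_definition one_rmax :: rmax is "0" by simp
lift_definition plus_rmax :: "rmax \<Rightarrow> rmax \<Rightarrow> rmax" is "max" by (simp add: max_def)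
lift_definition times_rmax :: "rmax \<Rightarrow> rmax \<Rightarrow> rmax" is "(+)" by simp

instance
proof
  fix a b c :: rmax
  show "a * b * c = a * (b * c)" by transfer (simp add: add.assoc)
  show "a * b = b * a" by transfer (simp add: add.commute)
  show "1 * a = a" by transfer simp
  show "a + b + c = a + (b + c)" by transfer (simp add: max.assoc)
  show "a + b = b + a" by transfer (simp add: max.commute)
  show "0 + a = a" by transfer simp
  show "0 * a = 0" by transfer simp
  show "a * 0 = 0" by transfer simp
  show "(a + b) * c = a * c + b * c"
  proof transfer
    fix a b c :: ereal
    show "max a b + c = max (a + c) (b + c)"
      by (cases "a \<le> b") (simp_all add: max_def add_right_mono antisym)
  qed
  show "(0::rmax) \<noteq> 1" by transfer simp
qed

end

lemma rval_zero: "rval 0 = -\<infinity>" by transfer simp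
lemma rval_one: "rval 1 = 0" by transfer simp
lemma rval_plus: "rval (a + b) = max (rval a) (rval b)" by transfer simp
lemma rval_times: "rval (a * b) = rval a + rval b" by transfer simp

text \<open>An \<open>n \<times> 0\<close> by \<open>0 \<times> p\<close> product is the matrix with all entries \<open>-\<infinity>\<close>, which therefore has
  factor rank 0.\<close>

definition factor_rank :: "rmax mat \<Rightarrow> nat" where
  "factor_rank A = (LEAST r. \<exists>U L. U \<in> carrier_mat (dim_row A) r \<and>
     L \<in> carrier_mat r (dim_col A) \<and> A = U * L)"

section \<open>Digraphs of square matrices\<close>

text \<open>The \<open>n\<close> nodes are numbered from \<open>0\<close>, as the matrix indices of the library.\<close>

type_synonym digraph = "(nat, nat \<times> nat) pre_digraph"

definition mat_digraph :: "rmax mat \<Rightarrow> digraph" where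
  "mat_digraph A = \<lparr> verts = {0..<dim_row A},
     arcs = {(i, j). i < dim_row A \<and> j < dim_row A \<and> rval (A $$ (i, j)) \<noteq> -\<infinity>},
     tail = fst, head = snd \<rparr>"

definition irreducible_mat :: "rmax mat \<Rightarrow> bool" where
  "irreducible_mat A \<longleftrightarrow> strongly_connected (mat_digraph A)"

definition mean_weight :: "rmax mat \<Rightarrow> (nat \<times> nat) list \<Rightarrow> ereal" where
  "mean_weight A p = (\<Sum>e\<leftarrow>p. rval (A $$ e)) / ereal (real (length p))"

text \<open>Cycles in the graph library are elementary, so the supremum ranges over a finite set; it is a
  maximum unless there is no cycle, in which case it is \<open>-\<infinity>\<close>.\<close>

definition max_cycle_mean :: "rmax mat \<Rightarrow> ereal" where
  "max_cycle_mean A = (SUP p \<in> {p. pre_digraph.cycle (mat_digraph A) p}. mean_weight A p)"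

definition critical_cycle :: "rmax mat \<Rightarrow> (nat \<times> nat) list \<Rightarrow> bool" where
  "critical_cycle A p \<longleftrightarrow>
     pre_digraph.cycle (mat_digraph A) p \<and> mean_weight A p = max_cycle_mean A"

text \<open>The nodes of a cycle are the tails of its edges.\<close>

definition critical_digraph :: "rmax mat \<Rightarrow> digraph" where
  "critical_digraph A = \<lparr> verts = (\<Union>p \<in> {p. critical_cycle A p}. fst ` set p),
     arcs = (\<Union>p \<in> {p. critical_cycle A p}. set p),
     tail = fst, head = snd \<rparr>"

text \<open>\<open>sc_cyclicity\<close> is meant for strongly connected digraphs, \<open>cyclicity\<close> for disjoint unions of
  strongly connected digraphs.\<close>

definition sc_cyclicity :: "digraph \<Rightarrow> nat" where
  "sc_cyclicity H = Gcd (length ` {p. pre_digraph.cycle H p})"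

definition cyclicity :: "digraph \<Rightarrow> nat" where
  "cyclicity G = Lcm (sc_cyclicity ` pre_digraph.sccs G)"

section \<open>Normalised families of matrices\<close>

definition normalized :: "rmax mat \<Rightarrow> rmax mat" where
  "normalized A = map_mat (\<lambda>a. Rmax (rval a - max_cycle_mean A)) A"

text \<open>Suprema and infima are taken in the extended reals. \<open>Rmax\<close> is meaningful on the supremum only
  if the latter is not \<open>+\<infinity>\<close>, that is if \<open>sup_in_rmax\<close> holds.\<close>

definition sup_in_rmax :: "nat \<Rightarrow> rmax mat set \<Rightarrow> bool" where
  "sup_in_rmax n Y \<longleftrightarrow> (\<forall>i<n. \<forall>j<n. (SUP A\<in>Y. rval (A $$ (i, j))) \<noteq> \<infinity>)"

definition sup_mat :: "nat \<Rightarrow> rmax mat set \<Rightarrow> rmax mat" where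
  "sup_mat n Y = mat n n (\<lambda>ij. Rmax (SUP A\<in>Y. rval (A $$ ij)))"

definition inf_mat :: "nat \<Rightarrow> rmax mat set \<Rightarrow> rmax mat" where
  "inf_mat n Y = mat n n (\<lambda>ij. Rmax (INF A\<in>Y. rval (A $$ ij)))"

text \<open>The product \<open>A 1 * \<dots> * A k\<close>.\<close>

definition mat_product :: "nat \<Rightarrow> (nat \<Rightarrow> rmax mat) \<Rightarrow> nat \<Rightarrow> rmax mat" where
  "mat_product n A k = foldr (*) (map A [1..<Suc k]) (1\<^sub>m n)"

section \<open>CSR terms\<close>

text \<open>In \<open>support_mat\<close>, \<open>1\<close> and \<open>0\<close> are the semiring constants, i.e. the real number zero
  and \<open>-\<infinity>\<close>.\<close>

definition support_mat :: "nat \<Rightarrow> digraph \<Rightarrow> rmax mat" where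
  "support_mat n H = mat n n (\<lambda>ij. if ij \<in> arcs H then 1 else 0)"

definition transient :: "rmax mat \<Rightarrow> nat \<Rightarrow> nat" where
  "transient S g = (LEAST T. \<forall>l\<ge>T. S ^\<^sub>m (l + g) = S ^\<^sub>m l)"

definition CSR :: "nat \<Rightarrow> digraph \<Rightarrow> nat \<Rightarrow> nat \<Rightarrow> nat \<Rightarrow> rmax mat \<Rightarrow> rmax mat" where
  "CSR n H g t k G =
    (let S = support_mat n H;
         C = G * S ^\<^sub>m ((t + 1) * g - k mod g);
         R = S ^\<^sub>m ((t + 1) * g - k mod g) * G
     in C * S ^\<^sub>m (k mod g) * R)"

end

theory Submission
  imports Defs
begin

text \<open>Every CSR term has the form \<open>G S^l G\<close>, where \<open>S^l\<close> is the 0/1 matrix of the walks of length \<open>l\<close>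
  in the critical digraph and \<open>l\<close> is so large that \<open>S^(l + g) = S^l\<close>. Hence its factor rank is at
  most the number of distinct nonzero rows of \<open>S^l\<close>. If two nodes of one component are reached from
  a fixed node by walks whose lengths agree modulo the cyclicity of that component, then each of them
  is reached from the other by a walk whose length is a multiple of it, so periodicity gives them
  the same row. A component therefore contributes at most its cyclicity many rows.

  That the cyclicity is an eventual period of the powers needs no decomposition of walks: some
  eventual period exists because there are finitely many relations, inserting closed walks shows
  that every cycle length is one, and the least eventual period divides all the others, hence also
  the gcd of the cycle lengths.\<close>

section \<open>Eventual periods of sequences\<close>

definition eventual_period :: "nat \<Rightarrow> (nat \<Rightarrow> 'a) \<Rightarrow> bool" where
  "eventual_period p f \<longleftrightarrow> (\<exists>T. \<forall>l\<ge>T. f (l + p) = f l)"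

lemma period_mult:
  fixes T :: nat
  assumes "\<forall>l\<ge>T. f (l + p) = f l" and "T \<le> l"
  shows "f (l + m * p) = f l"
proof (induction m)
  case (Suc m)
  have "f (l + Suc m * p) = f ((l + m * p) + p)" by (simp add: algebra_simps)
  with assms Suc show ?case by simp
qed simp

text \<open>Past both thresholds, adding \<open>q div p\<close> periods \<open>p\<close> to
  \<open>l + q mod p\<close> gives \<open>l + q\<close>, and one period \<open>q\<close> leads back
  to \<open>l\<close>.\<close>

lemma eventual_period_mod:
  assumes "eventual_period p f" and "eventual_period q f"
  shows "eventual_period (q mod p) f"
proof -
  obtain T U where T: "\<forall>l\<ge>T. f (l + p) = f l" and U: "\<forall>l\<ge>U. f (l + q) = f l"
    using assms by (auto simp: eventual_period_def)
  have "f (l + q mod p) = f l" if "l \<ge> max T U" for l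
  proof -
    have "f (l + q mod p) = f ((l + q mod p) + (q div p) * p)"
      by (rule period_mult[OF T, symmetric]) (use that in simp)
    also have "(l + q mod p) + (q div p) * p = l + q" by simp
    finally show ?thesis using U that by simp
  qed
  then show ?thesis unfolding eventual_period_def by blast
qed

lemma eventual_period_mult:
  assumes "eventual_period p f" and "p dvd q"
  shows "eventual_period q f"
  using assms period_mult unfolding eventual_period_def by (metis dvdE mult.commute)

text \<open>The period \<open>p\<close> guarantees that a least positive one, \<open>m\<close>,
  exists; remainders modulo \<open>m\<close> are again eventual periods, so minimality makes them
  zero.\<close>

lemma eventual_period_Gcd:
  assumes "eventual_period p f" and "p > 0" and Q: "\<And>q. q \<in> Q \<Longrightarrow> eventual_period q f"
  shows "eventual_period (Gcd Q) f"
proof -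
  define m where "m = (LEAST p. p > 0 \<and> eventual_period p f)"
  have m: "m > 0" "eventual_period m f"
    using LeastI[of "\<lambda>p. p > 0 \<and> eventual_period p f" p] assms by (auto simp: m_def)
  have "m dvd q" if "q \<in> Q" for q
  proof (rule ccontr)
    assume "\<not> m dvd q"
    then have "0 < q mod m" by (simp add: mod_greater_zero_iff_not_dvd)
    then have "m \<le> q mod m"
      unfolding m_def using eventual_period_mod[OF m(2) Q[OF that]]
      by (intro Least_le) (simp add: m_def)
    with mod_less_divisor[OF m(1), of q] show False by simp
  qed
  then have "m dvd Gcd Q" by (rule Gcd_greatest)
  with m(2) show ?thesis by (rule eventual_period_mult)
qed

section \<open>Powers of a strongly connected relation\<close>

lemma relpow_trans: "(x, y) \<in> R ^^ m \<Longrightarrow> (y, z) \<in> R ^^ l \<Longrightarrow> (x, z) \<in> R ^^ (m + l)"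
  by (auto simp: relpow_add)

lemma relpow_loop: "(x, x) \<in> R ^^ m \<Longrightarrow> (x, x) \<in> R ^^ (q * m)"
  by (induction q) (auto intro: relpow_trans)

lemma relpow_subset: "R \<subseteq> V \<times> V \<Longrightarrow> l > 0 \<Longrightarrow> R ^^ l \<subseteq> V \<times> V"
proof (induction l)
  case (Suc l)
  then show ?case by (cases l) auto
qed simp

lemma relpow_eventual_period_ex:
  fixes R :: "'a rel"
  assumes "finite R"
  obtains p where "p > 0" and "eventual_period p (\<lambda>l. R ^^ l)"
proof -
  have "R \<subseteq> Field R \<times> Field R" by (auto simp: Field_def)
  \<comment> \<open>\<open>Id\<close> is listed apart because the zeroth power is the identity on
    the whole type, in general not within the field of \<open>R\<close>.\<close>
  then have "R ^^ l \<in> insert Id (Pow (Field R \<times> Field R))" for l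
    using relpow_subset[of R "Field R" l] by (cases "l = 0") auto
  then have "range (\<lambda>l. R ^^ l) \<subseteq> insert Id (Pow (Field R \<times> Field R))" by blast
  then have "finite (range (\<lambda>l. R ^^ l))"
    by (rule finite_subset) (simp add: finite_Field[OF assms])
  then have "\<not> inj (\<lambda>l::nat. R ^^ l)" using finite_imageD infinite_UNIV_nat by blast
  then obtain a b :: nat where ab: "R ^^ a = R ^^ b" "a < b"
    unfolding inj_def by (metis linorder_neqE_nat)
  have "R ^^ (l + (b - a)) = R ^^ l" if "l \<ge> a" for l
  proof -
    have "R ^^ (l + (b - a)) = R ^^ (b + (l - a))"
      using that ab(2) by (simp add: add.commute)
    also have "\<dots> = R ^^ (a + (l - a))" by (simp only: relpow_add ab(1))
    finally show ?thesis using that by simp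
  qed
  then show ?thesis using that[of "b - a"] ab(2) by (auto simp: eventual_period_def)
qed

text \<open>A detour through \<open>u\<close> and round its closed walk lengthens any walk by
  \<open>c\<close> modulo a known period \<open>p\<close>, so the powers grow along steps of
  \<open>c\<close>. After \<open>p\<close> such steps the power is the initial one again, hence all
  inclusions are equalities.\<close>

lemma closed_walk_eventual_period:
  assumes fin: "finite R" and RV: "R \<subseteq> V \<times> V"
    and sc: "\<And>i j. i \<in> V \<Longrightarrow> j \<in> V \<Longrightarrow> (i, j) \<in> R\<^sup>*"
    and u: "u \<in> V" "(u, u) \<in> R ^^ c"
  shows "eventual_period c (\<lambda>l. R ^^ l)"
proof -
  obtain p where "p > 0" "eventual_period p (\<lambda>l. R ^^ l)"
    using relpow_eventual_period_ex[OF fin] .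
  then obtain T where T: "\<forall>l\<ge>T. R ^^ (l + p) = R ^^ l" by (auto simp: eventual_period_def)
  have mono: "R ^^ l \<subseteq> R ^^ (l + c)" if l: "l \<ge> Suc T" for l
  proof (rule subrelI)
    fix i j assume ij: "(i, j) \<in> R ^^ l"
    then have "i \<in> V" using relpow_subset[OF RV, of l] l by auto
    then obtain a b where "(i, u) \<in> R ^^ a" and "(u, i) \<in> R ^^ b"
      using sc u(1) by (meson rtrancl_imp_relpow)
    \<comment> \<open>The plain round trip of length \<open>a + b\<close> is repeated
      \<open>p - 1\<close> times, so that apart from \<open>c\<close> the added length is the
      multiple \<open>(a + b) * p\<close> of the period.\<close>
    then have "(i, i) \<in> R ^^ (a + c + b)" and "(i, i) \<in> R ^^ ((p - 1) * (a + b))"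
      using u(2) by (auto intro: relpow_trans relpow_loop)
    then have "(i, j) \<in> R ^^ (a + c + b + ((p - 1) * (a + b) + l))"
      using ij by (blast intro: relpow_trans)
    also have "a + c + b + ((p - 1) * (a + b) + l) = (l + c) + (a + b) * p"
      using \<open>p > 0\<close> by (cases p) (auto simp: algebra_simps)
    also have "R ^^ \<dots> = R ^^ (l + c)"
      by (rule period_mult[OF T]) (use l in simp)
    finally show "(i, j) \<in> R ^^ (l + c)" .
  qed
  have mono': "R ^^ l \<subseteq> R ^^ (l + q * c)" if "l \<ge> Suc T" for l q
  proof (induction q)
    case (Suc q)
    also have "R ^^ (l + q * c) \<subseteq> R ^^ ((l + q * c) + c)" by (rule mono) (use that in simp)
    finally show ?case by (simp add: algebra_simps)
  qed simp
  have "R ^^ (l + c) = R ^^ l" if l: "l \<ge> Suc T" for l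
  proof
    \<comment> \<open>The remaining \<open>p - 1\<close> steps of \<open>c\<close> close the chain
      of inclusions at \<open>l + c * p\<close>, which is \<open>l\<close> up to periods.\<close>
    have "R ^^ (l + c) \<subseteq> R ^^ (l + c + (p - 1) * c)" by (rule mono') (use l in simp)
    also have "l + c + (p - 1) * c = l + c * p"
      using \<open>p > 0\<close> by (cases p) (auto simp: algebra_simps)
    also have "R ^^ \<dots> = R ^^ l" by (rule period_mult[OF T]) (use l in simp)
    finally show "R ^^ (l + c) \<subseteq> R ^^ l" .
  qed (rule mono[OF l])
  then show ?thesis unfolding eventual_period_def by blast
qed

text \<open>Colour each node by the length modulo \<open>g\<close> of a chosen walk to it from a
  fixed node. Equal colours give equal rows, and there are only \<open>g\<close> colours.\<close>

lemma card_relpow_rows: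
  assumes sc: "\<And>i j. i \<in> V \<Longrightarrow> j \<in> V \<Longrightarrow> (i, j) \<in> R\<^sup>*"
    and g: "g > 0" and per: "\<And>q. R ^^ (l + q * g) = R ^^ l"
  shows "finite ((\<lambda>i. (R ^^ l) `` {i}) ` V)" and "card ((\<lambda>i. (R ^^ l) `` {i}) ` V) \<le> g"
proof -
  let ?F = "\<lambda>i. (R ^^ l) `` {i}"
  have "\<forall>v i. \<exists>a. v \<in> V \<longrightarrow> i \<in> V \<longrightarrow> (v, i) \<in> R ^^ a"
    using sc rtrancl_imp_relpow by metis
  then obtain m where m: "\<And>i v. i \<in> V \<Longrightarrow> v \<in> V \<Longrightarrow> (v, i) \<in> R ^^ m v i"
    by metis
  have sub: "?F i' \<subseteq> ?F i"
    if v: "v \<in> V" and i: "i \<in> V" and i': "i' \<in> V" and eq: "m v i mod g = m v i' mod g" for v i i'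
  proof
    fix y assume "y \<in> ?F i'"
    let ?r = "m i v"
    \<comment> \<open>After \<open>g - 1\<close> extra closed walks at \<open>v\<close>, the walk from \<open>i\<close> to \<open>v\<close> has length \<open>- m v i\<close> modulo
      \<open>g\<close>.\<close>
    let ?w = "?r + (g - 1) * (m v i + ?r) + m v i'"
    have "(v, v) \<in> R ^^ (m v i + ?r)" using m i v by (blast intro: relpow_trans)
    then have w: "(i, i') \<in> R ^^ ?w"
      using m v i i' by (blast intro: relpow_trans relpow_loop)
    have "?w + m v i = m v i' + g * (?r + m v i)"
      using g by (cases g) (auto simp: algebra_simps)
    then have "(?w + m v i) mod g = m v i mod g" using eq by (simp only: mod_mult_self2)
    then have "g dvd ?w" by (simp only: mod_eq_dvd_iff_nat le_add2 add_diff_cancel_right')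
    then obtain q where "?w = q * g" by (metis dvdE mult.commute)
    \<comment> \<open>Prefixing the walk from \<open>i\<close> to \<open>i'\<close>, of length
      \<open>q * g\<close>, to one from \<open>i'\<close> to \<open>y\<close> costs nothing, by
      \<open>per\<close>.\<close>
    with w \<open>y \<in> ?F i'\<close> have "(i, y) \<in> R ^^ (q * g + l)" by (auto intro: relpow_trans)
    then show "y \<in> ?F i" using per[of q] by (simp add: add.commute)
  qed
  have "finite (?F ` V) \<and> card (?F ` V) \<le> g"
  proof (cases "V = {}")
    case False
    then obtain v where v: "v \<in> V" by blast
    \<comment> \<open>A row is coloured through one representative node, picked by
      \<open>inv_into\<close>.\<close>
    let ?h = "\<lambda>X. m v (inv_into V ?F X) mod g"
    have inj: "inj_on ?h (?F ` V)"
    proof (rule inj_onI)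
      fix X Y assume XY: "X \<in> ?F ` V" "Y \<in> ?F ` V" and h: "?h X = ?h Y"
      have "inv_into V ?F X \<in> V" "inv_into V ?F Y \<in> V" using XY by (auto intro: inv_into_into)
      then have "?F (inv_into V ?F X) = ?F (inv_into V ?F Y)"
        using sub[OF v] h by (metis subset_antisym)
      then show "X = Y" using f_inv_into_f[OF XY(1)] f_inv_into_f[OF XY(2)] by simp
    qed
    have im: "?h ` (?F ` V) \<subseteq> {..<g}" using g by auto
    show ?thesis using inj_on_finite[OF inj im] card_inj_on_le[OF inj im] by simp
  qed simp
  then show "finite (?F ` V)" and "card (?F ` V) \<le> g" by simp_all
qed

section \<open>Boolean max-plus matrices\<close>

text \<open>\<open>support_mat\<close> for an arbitrary relation, so that matrix powers can be read
  as relation powers.\<close>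

definition rel_mat :: "nat \<Rightarrow> (nat \<times> nat) set \<Rightarrow> rmax mat" where
  "rel_mat n R = mat n n (\<lambda>ij. if ij \<in> R then 1 else 0)"

text \<open>Idempotence of the maximum, in the form in which the simplifier meets
  \<open>1 + 1\<close>.\<close>

lemma rmax_two: "(2 :: rmax) = 1"
  unfolding one_add_one[symmetric] by transfer simp

lemma rmax_sum_indicator:
  "finite I \<Longrightarrow> (\<Sum>i\<in>I. if P i then 1 else 0 :: rmax) = (if \<exists>i\<in>I. P i then 1 else 0)"
  by (induction I rule: finite_induct) (auto simp: rmax_two)

text \<open>Rectangular, since it serves both for composing relations and for the factorization
  through \<open>card \<F>\<close> columns below.\<close>

lemma indicator_mat_mult:
  "mat a b (\<lambda>(i, j). if P i j then 1 else 0 :: rmax) * mat b c (\<lambda>(i, j). if Q i j then 1 else 0) =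
   mat a c (\<lambda>(i, j). if \<exists>l<b. P i l \<and> Q l j then 1 else 0)"
proof (rule eq_matI)
  fix i j
  assume "i < dim_row (mat a c (\<lambda>(i, j). if \<exists>l<b. P i l \<and> Q l j then 1 else 0 :: rmax))"
    and "j < dim_col (mat a c (\<lambda>(i, j). if \<exists>l<b. P i l \<and> Q l j then 1 else 0 :: rmax))"
  then have ij: "i < a" "j < c" by simp_all
  have "(mat a b (\<lambda>(i, j). if P i j then 1 else 0 :: rmax) *
      mat b c (\<lambda>(i, j). if Q i j then 1 else 0)) $$ (i, j) =
      (\<Sum>l = 0..<b. (if P i l then 1 else 0) * (if Q l j then 1 else 0))"
    using ij by (simp add: scalar_prod_def)
  also have "\<dots> = (\<Sum>l = 0..<b. if P i l \<and> Q l j then 1 else 0)"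
    by (rule sum.cong) auto
  finally show "(mat a b (\<lambda>(i, j). if P i j then 1 else 0 :: rmax) *
      mat b c (\<lambda>(i, j). if Q i j then 1 else 0)) $$ (i, j) =
      mat a c (\<lambda>(i, j). if \<exists>l<b. P i l \<and> Q l j then 1 else 0) $$ (i, j)"
    using ij by (auto simp: rmax_sum_indicator)
qed simp_all

lemma rel_mat_alt: "rel_mat n R = mat n n (\<lambda>(i, j). if (i, j) \<in> R then 1 else 0)"
  by (auto simp: rel_mat_def)

lemma rel_mat_carrier [simp]: "rel_mat n R \<in> carrier_mat n n"
  by (simp add: rel_mat_def)

text \<open>The bound on \<open>Q\<close> keeps the middle node of a composition among the indices
  over which the matrix product runs.\<close>

lemma rel_mat_mult:
  assumes "Q \<subseteq> {..<n} \<times> UNIV"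
  shows "rel_mat n R * rel_mat n Q = rel_mat n (R O Q)"
  using assms unfolding rel_mat_alt indicator_mat_mult by (intro cong_mat) auto

lemma rel_mat_pow:
  assumes "R \<subseteq> {..<n} \<times> UNIV"
  shows "rel_mat n R ^\<^sub>m l = rel_mat n (R ^^ l)"
proof (induction l)
  case 0
  show ?case by (rule eq_matI) (auto simp: rel_mat_def one_mat_def)
next
  case (Suc l)
  with assms show ?case by (simp add: rel_mat_mult)
qed

text \<open>Carries periodicity of matrix powers back to relations; the bounds exclude pairs that
  the matrix cannot see.\<close>

lemma rel_mat_inj:
  assumes "rel_mat n R = rel_mat n Q" and "R \<subseteq> {..<n} \<times> {..<n}" and "Q \<subseteq> {..<n} \<times> {..<n}"
  shows "R = Q"
proof -
  have "(i, j) \<in> R \<longleftrightarrow> (i, j) \<in> Q" if "i < n" "j < n" for i j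
    using arg_cong[OF assms(1), of "\<lambda>B. B $$ (i, j)"] that
    by (auto simp: rel_mat_def split: if_splits)
  with assms(2,3) show ?thesis by auto
qed

text \<open>\<open>L\<close> has the members of \<open>\<F>\<close> as rows and \<open>U\<close>
  selects for each node the member equal to its row. An empty row may be missing from
  \<open>\<F>\<close>: it comes from a zero row of \<open>U\<close>.\<close>

lemma rel_mat_factorization:
  assumes fin: "finite \<F>" and rows: "\<And>i j. (i, j) \<in> R \<Longrightarrow> R `` {i} \<in> \<F>"
  obtains U L where "U \<in> carrier_mat n (card \<F>)" and "L \<in> carrier_mat (card \<F>) n"
    and "rel_mat n R = U * L"
proof -
  obtain h where h: "bij_betw h {0..<card \<F>} \<F>" using ex_bij_betw_nat_finite[OF fin] by blast
  let ?U = "mat n (card \<F>) (\<lambda>(i, c). if R `` {i} = h c then 1 else 0 :: rmax)"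
  let ?L = "mat (card \<F>) n (\<lambda>(c, j). if j \<in> h c then 1 else 0 :: rmax)"
  have "(i, j) \<in> R \<longleftrightarrow> (\<exists>c<card \<F>. R `` {i} = h c \<and> j \<in> h c)" for i j
  proof
    assume ij: "(i, j) \<in> R"
    then have "R `` {i} \<in> h ` {0..<card \<F>}"
      using rows bij_betw_imp_surj_on[OF h] by simp
    then obtain c where "c < card \<F>" "R `` {i} = h c" by auto
    with ij show "\<exists>c<card \<F>. R `` {i} = h c \<and> j \<in> h c" by blast
  qed blast
  then have "rel_mat n R = ?U * ?L" unfolding rel_mat_alt indicator_mat_mult by simp
  then show ?thesis by (rule that[rotated 2]) simp_all
qed

lemma factor_rank_le:
  assumes "U \<in> carrier_mat (dim_row A) r" and "L \<in> carrier_mat r (dim_col A)" and "A = U * L"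
  shows "factor_rank A \<le> r"
  unfolding factor_rank_def using assms by (intro Least_le) blast

lemma factor_rank_sandwich_le:
  assumes G: "G \<in> carrier_mat n n" "G' \<in> carrier_mat n n"
    and "finite \<F>" and "\<And>i j. (i, j) \<in> R \<Longrightarrow> R `` {i} \<in> \<F>"
  shows "factor_rank (G * rel_mat n R * G') \<le> card \<F>"
proof -
  obtain U L where UL: "U \<in> carrier_mat n (card \<F>)" "L \<in> carrier_mat (card \<F>) n"
    and eq: "rel_mat n R = U * L"
    using rel_mat_factorization assms(3,4) by metis
  show ?thesis
  proof (rule factor_rank_le)
    show "G * U \<in> carrier_mat (dim_row (G * rel_mat n R * G')) (card \<F>)" using G UL by simp
    show "L * G' \<in> carrier_mat (card \<F>) (dim_col (G * rel_mat n R * G'))" using G UL by simp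
    have "G * (U * L) * G' = (G * U) * L * G'" using G UL by simp
    also have "\<dots> = (G * U) * (L * G')" using G UL by (intro assoc_mult_mat) auto
    finally show "G * rel_mat n R * G' = (G * U) * (L * G')" by (simp add: eq)
  qed
qed

section \<open>Digraphs covered by their cycles\<close>

lemma walk_relpow:
  assumes "tail H = fst" and "head H = snd"
  shows "pre_digraph.cas H u p v \<Longrightarrow> set p \<subseteq> arcs H \<Longrightarrow> (u, v) \<in> arcs H ^^ length p"
proof (induction p arbitrary: u)
  case Nil
  then show ?case by (simp add: pre_digraph.cas.simps)
next
  case (Cons e p)
  then have "(u, snd e) \<in> arcs H" and "(snd e, v) \<in> arcs H ^^ length p"
    using assms by (auto simp: pre_digraph.cas.simps)
  then show ?case by (simp only: list.size add_Suc_right add_0_right relpow_Suc_I2)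
qed

lemma cycle_relpow:
  assumes "tail H = fst" and "head H = snd" and "pre_digraph.cycle H p"
  obtains u where "u \<in> verts H" and "(u, u) \<in> arcs H ^^ length p"
  using assms walk_relpow by (metis pre_digraph.awalk_def pre_digraph.cycle_def)

text \<open>Each inner node of a walk is the head of one edge and the tail of the next, so heads and
  tails differ at most in the endpoints.\<close>

lemma cas_heads_tails:
  "pre_digraph.cas G u p v \<Longrightarrow> insert u (head G ` set p) = insert v (tail G ` set p)"
  by (induction p arbitrary: u) (auto simp: pre_digraph.cas.simps insert_commute)

lemma cycle_heads_eq_tails:
  assumes "pre_digraph.cycle G p"
  shows "head G ` set p = tail G ` set p"
proof -
  obtain u where cas: "pre_digraph.cas G u p u" and p: "p \<noteq> []"
    using assms by (auto simp: pre_digraph.cycle_def pre_digraph.awalk_def)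
  then have "u \<in> tail G ` set p" by (cases p) (auto simp: pre_digraph.cas.simps)
  moreover have "u \<in> head G ` set p"
    using cas p
  proof (induction p arbitrary: u rule: rev_induct)
    case (snoc e p)
    have "pre_digraph.cas G x (p @ [e]) y \<Longrightarrow> head G e = y" for x y
      by (induction p arbitrary: x) (auto simp: pre_digraph.cas.simps)
    with snoc show ?case by force
  qed simp
  ultimately show ?thesis using cas_heads_tails[OF cas] by (simp add: insert_absorb)
qed

text \<open>Chaining and distinctness depend only on the \<open>tail\<close> and \<open>head\<close>
  maps, which compatible digraphs share; what remains is membership.\<close>

lemma cycle_transfer:
  assumes "pre_digraph.cycle G p" and "compatible G H" and "set p \<subseteq> arcs H"
    and "tail G ` set p \<subseteq> verts H"
  shows "pre_digraph.cycle H p"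
proof -
  obtain u where u: "pre_digraph.cas G u p u" "distinct (tl (pre_digraph.awalk_verts G u p))" "p \<noteq> []"
    using assms by (auto simp: pre_digraph.cycle_def pre_digraph.awalk_def)
  then have "u \<in> verts H" using assms(4) by (cases p) (auto simp: pre_digraph.cas.simps)
  with u assms show ?thesis
    by (auto simp: pre_digraph.cycle_def pre_digraph.awalk_def compatible_cas[OF assms(2)]
        compatible_awalk_verts[OF assms(2)])
qed

text \<open>All nodes of the cycle are reachable from \<open>u\<close> and reach \<open>u\<close>,
  and a component, being induced, contains every arc between its nodes.\<close>

lemma cycle_in_scc:
  assumes "wf_digraph G" and p: "pre_digraph.cycle G p"
  obtains H where "H \<in> pre_digraph.sccs G" and "pre_digraph.cycle H p"
proof -
  interpret wf_digraph G by fact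
  obtain u where u: "awalk u p u" "p \<noteq> []" using p by (auto simp: cycle_def)
  have "scc_of u \<in> verts ` sccs"
    using u scc_of_in_sccs_verts by (auto simp: sccs_verts_conv)
  then obtain H where H: "H \<in> sccs" "scc_of u = verts H" by auto
  have "set (awalk_verts u p) \<subseteq> scc_of u"
    using u(1) awalk_verts_reachable_from awalk_verts_reachable_to by (auto simp: scc_of_def)
  then have ends: "tail G ` set p \<subseteq> verts H" "head G ` set p \<subseteq> verts H"
    using set_awalk_verts[OF u(1)] H(2) by auto
  have ind: "induced_subgraph H G" using H(1) by (rule in_sccs_imp_induced)
  then have "set p \<subseteq> arcs H" using ends u(1) by (auto simp: awalk_def induced_subgraph_def)
  moreover have "compatible G H" using ind by (auto simp: induced_subgraph_def subgraph_def)
  ultimately show ?thesis using that H(1) cycle_transfer p ends(1) by blast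
qed

text \<open>What later arguments use of the shape of a critical digraph, freed from weights: the
  cycles meant are those of \<open>G\<close> itself.\<close>

definition covered_by_cycles :: "digraph \<Rightarrow> bool" where
  "covered_by_cycles G \<longleftrightarrow>
     tail G = fst \<and> head G = snd \<and>
     verts G = (\<Union>p\<in>{p. pre_digraph.cycle G p}. fst ` set p) \<and>
     arcs G = (\<Union>p\<in>{p. pre_digraph.cycle G p}. set p)"

lemma covered_by_cycles_wf:
  assumes "covered_by_cycles G"
  shows "wf_digraph G"
proof
  fix e assume "e \<in> arcs G"
  then obtain p where p: "pre_digraph.cycle G p" "e \<in> set p"
    using assms by (auto simp: covered_by_cycles_def)
  then have "tail G e \<in> tail G ` set p" "head G e \<in> tail G ` set p"
    using cycle_heads_eq_tails[OF p(1)] by auto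
  then show "tail G e \<in> verts G" and "head G e \<in> verts G"
    using assms p(1) by (auto simp: covered_by_cycles_def)
qed

text \<open>Critical cycles remain cycles inside the critical digraph, which gives one inclusion;
  the other holds because a cycle of this digraph consists of its own arcs.\<close>

lemma critical_digraph_covered_by_cycles: "covered_by_cycles (critical_digraph M)"
proof -
  have comp: "compatible (mat_digraph M) (critical_digraph M)"
    by (simp add: compatible_def mat_digraph_def critical_digraph_def)
  have *: "pre_digraph.cycle (critical_digraph M) p" if "critical_cycle M p" for p
    by (rule cycle_transfer[OF _ comp])
      (use that in \<open>auto simp: critical_cycle_def critical_digraph_def mat_digraph_def\<close>)
  have **: "set p \<subseteq> arcs (critical_digraph M)" if "pre_digraph.cycle (critical_digraph M) p" for p
    using that by (auto simp: pre_digraph.cycle_def pre_digraph.awalk_def)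
  have tl_in: "fst e \<in> verts (critical_digraph M)" if "e \<in> arcs (critical_digraph M)" for e
    using that by (auto simp: critical_digraph_def)
  have V: "verts (critical_digraph M) = (\<Union>p\<in>{p. critical_cycle M p}. fst ` set p)"
    and A: "arcs (critical_digraph M) = (\<Union>p\<in>{p. critical_cycle M p}. set p)"
    by (simp_all add: critical_digraph_def)
  have "verts (critical_digraph M) = (\<Union>p\<in>{p. pre_digraph.cycle (critical_digraph M) p}. fst ` set p)"
  proof
    show "verts (critical_digraph M) \<subseteq> (\<Union>p\<in>{p. pre_digraph.cycle (critical_digraph M) p}. fst ` set p)"
      unfolding V using * by blast
  qed (use ** tl_in in blast)
  moreover have "arcs (critical_digraph M) = (\<Union>p\<in>{p. pre_digraph.cycle (critical_digraph M) p}. set p)"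
  proof
    show "arcs (critical_digraph M) \<subseteq> (\<Union>p\<in>{p. pre_digraph.cycle (critical_digraph M) p}. set p)"
      unfolding A using * by blast
  qed (use ** in blast)
  moreover have "tail (critical_digraph M) = fst" "head (critical_digraph M) = snd"
    by (simp_all add: critical_digraph_def)
  ultimately show ?thesis unfolding covered_by_cycles_def by (intro conjI)
qed

lemma critical_digraph_bounds:
  assumes "M \<in> carrier_mat n n"
  shows "verts (critical_digraph M) \<subseteq> {..<n}" and "arcs (critical_digraph M) \<subseteq> {..<n} \<times> {..<n}"
proof -
  have "set p \<subseteq> {..<n} \<times> {..<n}" if "critical_cycle M p" for p
    using that assms
    by (auto simp: critical_cycle_def pre_digraph.cycle_def pre_digraph.awalk_def mat_digraph_def)
  then show "arcs (critical_digraph M) \<subseteq> {..<n} \<times> {..<n}"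
    and "verts (critical_digraph M) \<subseteq> {..<n}"
    by (fastforce simp: critical_digraph_def)+
qed

section \<open>Strongly connected components of a digraph covered by its cycles\<close>

context
  fixes G :: digraph
  assumes cov: "covered_by_cycles G"
begin

interpretation wf_digraph G
  using cov by (rule covered_by_cycles_wf)

lemma scc_induced:
  assumes "H \<in> sccs"
  shows "tail H = fst" and "head H = snd" and "verts H \<subseteq> verts G"
    and "arcs H = {e \<in> arcs G. fst e \<in> verts H \<and> snd e \<in> verts H}"
proof -
  have "induced_subgraph H G" using assms by (rule in_sccs_imp_induced)
  then show "tail H = fst" "head H = snd" "verts H \<subseteq> verts G"
    and "arcs H = {e \<in> arcs G. fst e \<in> verts H \<and> snd e \<in> verts H}"
    using cov by (auto simp: covered_by_cycles_def induced_subgraph_def subgraph_def compatible_def)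
qed

lemma scc_rtrancl:
  assumes "H \<in> sccs" and "i \<in> verts H" and "j \<in> verts H"
  shows "(i, j) \<in> (arcs H)\<^sup>*"
proof -
  have "reachable H i j" using assms by (auto simp: sccs_def)
  moreover have "arcs_ends H = arcs H"
    using scc_induced[OF assms(1)] by (auto simp: arcs_ends_conv image_iff)
  ultimately show ?thesis by (metis reachable_rtranclI)
qed

lemma arc_in_scc:
  assumes "(i, j) \<in> arcs G"
  obtains H where "H \<in> sccs" and "i \<in> verts H" and "(i, j) \<in> arcs H"
proof -
  obtain p where p: "cycle p" "(i, j) \<in> set p" using assms cov by (auto simp: covered_by_cycles_def)
  obtain H where H: "H \<in> sccs" "pre_digraph.cycle H p" using cycle_in_scc[OF wf_digraph p(1)] .
  then have "(i, j) \<in> arcs H" using p(2) by (auto simp: pre_digraph.cycle_def pre_digraph.awalk_def)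
  then show ?thesis using that H(1) scc_induced(4)[OF H(1)] by auto
qed

text \<open>No arc leaves a component: it lies on a cycle, the cycle stays in one component, and
  components are disjoint.\<close>

lemma arc_from_scc:
  assumes "H \<in> sccs" and "i \<in> verts H" and "(i, j) \<in> arcs G"
  shows "(i, j) \<in> arcs H" and "j \<in> verts H"
proof -
  obtain H' where "H' \<in> sccs" "i \<in> verts H'" "(i, j) \<in> arcs H'" using arc_in_scc[OF assms(3)] .
  moreover from this have "H' = H" using scc_disj assms(1,2) by blast
  ultimately show "(i, j) \<in> arcs H" by simp
  then show "j \<in> verts H" using scc_induced(4)[OF assms(1)] by auto
qed

text \<open>Reduces rows of powers of the whole digraph to rows of powers of a single
  component.\<close>

lemma walk_from_scc:
  assumes H: "H \<in> sccs" and i: "i \<in> verts H"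
  shows "(arcs G ^^ l) `` {i} = (arcs H ^^ l) `` {i}"
proof -
  have "(i, j) \<in> arcs H ^^ l \<and> j \<in> verts H" if "(i, j) \<in> arcs G ^^ l" for j
    using that
  proof (induction l arbitrary: j)
    case (Suc l)
    then show ?case using arc_from_scc[OF H] by fastforce
  qed (simp add: i)
  moreover have "(i, j) \<in> arcs G ^^ l" if "(i, j) \<in> arcs H ^^ l" for j
    using that
  proof (induction l arbitrary: j)
    case (Suc l)
    then show ?case using scc_induced(4)[OF H] by fastforce
  qed simp
  ultimately show ?thesis by auto
qed

text \<open>Rules out a lone node without a loop, whose gcd of cycle lengths would be 0. The
  component holding a cycle through \<open>v\<close> shares \<open>v\<close> with \<open>H\<close>,
  so it is \<open>H\<close>.\<close>

lemma scc_has_cycle: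
  assumes H: "H \<in> sccs"
  obtains p where "pre_digraph.cycle H p"
proof -
  obtain v where "v \<in> verts H" using H by (auto simp: sccs_def strongly_connected_def)
  moreover from this obtain p j where "cycle p" "(v, j) \<in> set p"
    using scc_induced(3)[OF H] cov by (auto simp: covered_by_cycles_def)
  moreover obtain H' where "H' \<in> sccs" "pre_digraph.cycle H' p"
    using cycle_in_scc[OF wf_digraph \<open>cycle p\<close>] .
  moreover from this have "(v, j) \<in> arcs H'"
    using \<open>(v, j) \<in> set p\<close> by (auto simp: pre_digraph.cycle_def pre_digraph.awalk_def)
  then have "v \<in> verts H'" using scc_induced(4)[OF \<open>H' \<in> sccs\<close>] by simp
  ultimately show ?thesis using that scc_disj[OF H] by blast
qed

lemma scc_cyclicity:
  assumes fin: "finite (arcs G)" and H: "H \<in> sccs"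
  shows "sc_cyclicity H > 0" and "eventual_period (sc_cyclicity H) (\<lambda>l. arcs H ^^ l)"
proof -
  obtain p where p: "pre_digraph.cycle H p" using scc_has_cycle[OF H] .
  then have "length p > 0" by (auto simp: pre_digraph.cycle_def)
  have per: "eventual_period (length q) (\<lambda>l. arcs H ^^ l)" if q: "pre_digraph.cycle H q" for q
  proof -
    obtain u where "u \<in> verts H" "(u, u) \<in> arcs H ^^ length q"
      using cycle_relpow[OF scc_induced(1,2)[OF H] q] .
    moreover have "finite (arcs H)" "arcs H \<subseteq> verts H \<times> verts H"
      using fin scc_induced(4)[OF H] by auto
    ultimately show ?thesis
      using closed_walk_eventual_period[of "arcs H" "verts H"] scc_rtrancl[OF H] by blast
  qed
  show "eventual_period (sc_cyclicity H) (\<lambda>l. arcs H ^^ l)"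
    unfolding sc_cyclicity_def using per p \<open>length p > 0\<close>
    by (intro eventual_period_Gcd[OF per[OF p]]) auto
  show "sc_cyclicity H > 0"
  proof (rule ccontr)
    assume "\<not> sc_cyclicity H > 0"
    then have "length p = 0" unfolding sc_cyclicity_def using p by auto
    with \<open>length p > 0\<close> show False by simp
  qed
qed

lemma finite_sccs:
  assumes "finite (verts G)" and "finite (arcs G)"
  shows "finite sccs"
proof -
  interpret fin_digraph G using assms by (rule fin_digraphI)
  show ?thesis using finite_sccs_verts inj_on_verts_sccs by (simp add: sccs_verts_conv finite_image_iff)
qed

text \<open>Proved row by row: in a component the lcm is a multiple of that component's period, and
  elsewhere rows of positive powers are empty.\<close>

lemma cyclicity_eventual_period:
  assumes fin: "finite (verts G)" "finite (arcs G)"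
  shows "cyclicity G > 0" and "eventual_period (cyclicity G) (\<lambda>l. arcs G ^^ l)"
proof -
  note finS = finite_sccs[OF fin]
  have "0 \<noteq> sc_cyclicity H" if "H \<in> sccs" for H using scc_cyclicity(1)[OF fin(2) that] by simp
  then have "0 \<notin> sc_cyclicity ` sccs" by blast
  then have "Lcm (sc_cyclicity ` sccs) \<noteq> 0" using finS by (simp add: Lcm_0_iff)
  then show "cyclicity G > 0" by (simp add: cyclicity_def)
  have "\<forall>H\<in>sccs. \<exists>T. \<forall>l\<ge>T. arcs H ^^ (l + cyclicity G) = arcs H ^^ l"
    using eventual_period_mult[OF scc_cyclicity(2)[OF fin(2)], of _ "cyclicity G"]
    by (simp add: eventual_period_def cyclicity_def)
  then obtain T where T: "\<And>H l. H \<in> sccs \<Longrightarrow> l \<ge> T H \<Longrightarrow> arcs H ^^ (l + cyclicity G) = arcs H ^^ l"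
    by metis
  \<comment> \<open>The sum exceeds each threshold \<open>T H\<close>, and \<open>Suc\<close> makes
    \<open>l\<close> positive for the empty rows.\<close>
  define U where "U = Suc (\<Sum>H\<in>sccs. T H)"
  have "arcs G ^^ (l + cyclicity G) = arcs G ^^ l" if l: "l \<ge> U" for l
  proof -
    have "(arcs G ^^ (l + cyclicity G)) `` {i} = (arcs G ^^ l) `` {i}" for i
    proof (cases "\<exists>H\<in>sccs. i \<in> verts H")
      case True
      then obtain H where H: "H \<in> sccs" "i \<in> verts H" by blast
      have "T H \<le> l" using member_le_sum[of H sccs T] H(1) finS l by (simp add: U_def)
      then show ?thesis using T[OF H(1)] by (simp add: walk_from_scc[OF H])
    next
      case False
      have "(arcs G ^^ m) `` {i} = {}" if "m > 0" for m
      proof (rule ccontr)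
        assume "(arcs G ^^ m) `` {i} \<noteq> {}"
        then obtain j where "(i, j) \<in> arcs G ^^ m" by blast
        then obtain k where "(i, k) \<in> arcs G" using \<open>m > 0\<close> by (metis gr0_conv_Suc relpow_Suc_D2)
        then show False using False arc_in_scc by metis
      qed
      then show ?thesis using l by (simp add: U_def)
    qed
    then show ?thesis by (auto simp: set_eq_iff)
  qed
  then show "eventual_period (cyclicity G) (\<lambda>l. arcs G ^^ l)" by (auto simp: eventual_period_def)
qed

lemma card_scc_rows:
  assumes fin: "finite (arcs G)" and H: "H \<in> sccs" and g: "g > 0"
    and per: "\<And>q. arcs G ^^ (l + q * g) = arcs G ^^ l"
  shows "finite ((\<lambda>i. (arcs G ^^ l) `` {i}) ` verts H)"
    and "card ((\<lambda>i. (arcs G ^^ l) `` {i}) ` verts H) \<le> sc_cyclicity H"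
proof -
  obtain T where T: "\<forall>l\<ge>T. arcs H ^^ (l + sc_cyclicity H) = arcs H ^^ l"
    using scc_cyclicity(2)[OF fin H] by (auto simp: eventual_period_def)
  \<comment> \<open>\<open>l\<close> may lie below the threshold of \<open>H\<close>; shifting it by
    a multiple of \<open>g\<close> passes that threshold without changing the power of
    \<open>G\<close>.\<close>
  let ?l = "l + T * g"
  have "T \<le> ?l" using g by (simp add: trans_le_add2)
  have rows: "(\<lambda>i. (arcs G ^^ l) `` {i}) ` verts H = (\<lambda>i. (arcs H ^^ ?l) `` {i}) ` verts H"
    using walk_from_scc[OF H, of _ ?l] by (simp add: per)
  show "finite ((\<lambda>i. (arcs G ^^ l) `` {i}) ` verts H)"
    and "card ((\<lambda>i. (arcs G ^^ l) `` {i}) ` verts H) \<le> sc_cyclicity H"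
    unfolding rows
    using card_relpow_rows[of "verts H" "arcs H" "sc_cyclicity H" ?l] scc_rtrancl[OF H]
      scc_cyclicity(1)[OF fin H] period_mult[OF T \<open>T \<le> ?l\<close>] by blast+
qed

end

section \<open>Factor rank of CSR terms\<close>

lemma pow_mat_add:
  assumes "(A :: 'a :: semiring_1 mat) \<in> carrier_mat n n"
  shows "A ^\<^sub>m (a + b) = A ^\<^sub>m a * A ^\<^sub>m b"
proof (induction b)
  case (Suc b)
  then show ?case using assms by (simp add: assoc_mult_mat[of _ n n _ n _ n])
qed (use assms in simp)

text \<open>The three powers of \<open>S\<close> merge into one with exponent
  \<open>2 * a + b\<close>, where \<open>a\<close> is \<open>(t + 1) * g - k mod g\<close> and
  \<open>b\<close> is \<open>k mod g\<close>.\<close>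

lemma CSR_eq:
  assumes R: "arcs H \<subseteq> {..<n} \<times> {..<n}" and g: "g > 0"
    and per: "eventual_period g (\<lambda>l. arcs H ^^ l)"
    and t: "t * g \<ge> transient (support_mat n H) g" and G: "G \<in> carrier_mat n n"
  obtains l where "l > 0" and "\<forall>q. arcs H ^^ (l + q * g) = arcs H ^^ l"
    and "CSR n H g t k G = G * rel_mat n (arcs H ^^ l) * G"
proof -
  let ?S = "support_mat n H" and ?a = "(t + 1) * g - k mod g" and ?b = "k mod g"
  let ?l = "?a + ?b + ?a"
  have S: "?S \<in> carrier_mat n n" by (simp add: support_mat_def)
  have pow: "?S ^\<^sub>m l = rel_mat n (arcs H ^^ l)" for l
  proof -
    have "?S = rel_mat n (arcs H)" by (simp add: support_mat_def rel_mat_def)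
    with R show ?thesis by (simp add: rel_mat_pow subset_iff)
  qed
  \<comment> \<open>The \<open>LEAST\<close> in \<open>transient\<close> has its defining property
    only once some threshold is known to exist.\<close>
  have "\<exists>T. \<forall>l\<ge>T. ?S ^\<^sub>m (l + g) = ?S ^\<^sub>m l"
    using per unfolding eventual_period_def pow by metis
  then have stable: "\<forall>l\<ge>transient ?S g. ?S ^\<^sub>m (l + g) = ?S ^\<^sub>m l"
    unfolding transient_def by (rule LeastI_ex)
  \<comment> \<open>Hence already one exponent \<open>?a\<close> exceeds \<open>t * g\<close>, and
    so the transient.\<close>
  have "k mod g < g" using g by simp
  then have l: "?l > 0" "?l \<ge> transient ?S g" using t by simp_all
  have shift: "\<forall>q. arcs H ^^ (?l + q * g) = arcs H ^^ ?l"
  proof (intro allI, rule rel_mat_inj)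
    fix q
    show "rel_mat n (arcs H ^^ (?l + q * g)) = rel_mat n (arcs H ^^ ?l)"
      unfolding pow[symmetric] by (rule period_mult[OF stable l(2)])
  qed (use l(1) in \<open>intro relpow_subset[OF R]; simp\<close>)+
  have CSR: "CSR n H g t k G = G * rel_mat n (arcs H ^^ ?l) * G"
  proof -
    have *: "G * U * V * (U * G) = G * (U * V * U) * G"
      if "U \<in> carrier_mat n n" "V \<in> carrier_mat n n" for U V :: "rmax mat"
      using that G by (simp add: assoc_mult_mat[of _ n n _ n _ n])
    have "?S ^\<^sub>m l \<in> carrier_mat n n" for l unfolding pow by (rule rel_mat_carrier)
    note * [OF this this]
    then show ?thesis unfolding pow[symmetric] CSR_def Let_def pow_mat_add[OF S] .
  qed
  show ?thesis by (rule that[OF l(1) shift CSR])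
qed

lemma mat_product_carrier:
  assumes "\<forall>s\<in>{1..k}. A s \<in> carrier_mat n n"
  shows "mat_product n A k \<in> carrier_mat n n"
proof -
  have *: "foldr (*) Bs (1\<^sub>m n) \<in> carrier_mat n n" if "set Bs \<subseteq> carrier_mat n n" for Bs :: "rmax mat list"
    using that by (induction Bs) auto
  show ?thesis unfolding mat_product_def
    by (rule * ) (use assms in \<open>auto simp del: upt_Suc\<close>)
qed

text \<open>Since \<open>l > 0\<close>, nonempty rows start at nodes of \<open>H\<close>, and these
  nodes have at most \<open>sc_cyclicity H\<close> distinct rows.\<close>

lemma factor_rank_CSR_scc_le:
  assumes cov: "covered_by_cycles Cr" and Cr: "arcs Cr \<subseteq> {..<n} \<times> {..<n}"
    and G: "G \<in> carrier_mat n n" and H: "H \<in> pre_digraph.sccs Cr"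
    and t: "t * sc_cyclicity H \<ge> transient (support_mat n H) (sc_cyclicity H)"
  shows "factor_rank (CSR n H (sc_cyclicity H) t k G) \<le> sc_cyclicity H"
proof -
  have fin: "finite (arcs Cr)" using Cr by (rule finite_subset) simp
  have R: "arcs H \<subseteq> {..<n} \<times> {..<n}" "arcs H \<subseteq> verts H \<times> verts H"
    using Cr scc_induced(4)[OF cov H] by auto
  note g = scc_cyclicity[OF cov fin H]
  obtain l where l: "l > 0" "\<forall>q. arcs H ^^ (l + q * sc_cyclicity H) = arcs H ^^ l"
    and eq: "CSR n H (sc_cyclicity H) t k G = G * rel_mat n (arcs H ^^ l) * G"
    using CSR_eq[OF R(1) g t G, where k = k] .
  let ?F = "(\<lambda>i. (arcs H ^^ l) `` {i}) ` verts H"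
  have F: "finite ?F" "card ?F \<le> sc_cyclicity H"
    using card_relpow_rows[of "verts H" "arcs H" "sc_cyclicity H" l] scc_rtrancl[OF cov H] g(1) l(2)
    by blast+
  have "factor_rank (CSR n H (sc_cyclicity H) t k G) \<le> card ?F"
    unfolding eq
  proof (rule factor_rank_sandwich_le[OF G G F(1)])
    fix i j assume "(i, j) \<in> arcs H ^^ l"
    then show "(arcs H ^^ l) `` {i} \<in> ?F" using relpow_subset[OF R(2) l(1)] by blast
  qed
  with F(2) show ?thesis by simp
qed

text \<open>The row families of the components together contain every nonempty row, and their sizes
  add up to the bound.\<close>

lemma factor_rank_CSR_le:
  assumes cov: "covered_by_cycles Cr" and Cr: "arcs Cr \<subseteq> {..<n} \<times> {..<n}"
    and fin: "finite (verts Cr)" and G: "G \<in> carrier_mat n n"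
    and t: "t * cyclicity Cr \<ge> transient (support_mat n Cr) (cyclicity Cr)"
  shows "factor_rank (CSR n Cr (cyclicity Cr) t k G) \<le> (\<Sum>H\<in>pre_digraph.sccs Cr. sc_cyclicity H)"
proof -
  have fin': "finite (arcs Cr)" using Cr by (rule finite_subset) simp
  note g = cyclicity_eventual_period[OF cov fin fin']
  obtain l where l: "l > 0" "\<forall>q. arcs Cr ^^ (l + q * cyclicity Cr) = arcs Cr ^^ l"
    and eq: "CSR n Cr (cyclicity Cr) t k G = G * rel_mat n (arcs Cr ^^ l) * G"
    using CSR_eq[OF Cr g t G, where k = k] .
  let ?F = "\<lambda>H. (\<lambda>i. (arcs Cr ^^ l) `` {i}) ` verts H"
  note F = card_scc_rows[OF cov fin' _ g(1) l(2)[rule_format]]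
  note finS = finite_sccs[OF cov fin fin']
  have "factor_rank (CSR n Cr (cyclicity Cr) t k G) \<le> card (\<Union>H\<in>pre_digraph.sccs Cr. ?F H)"
    unfolding eq
  proof (rule factor_rank_sandwich_le[OF G G])
    show "finite (\<Union>H\<in>pre_digraph.sccs Cr. ?F H)" using finS F(1) by blast
    fix i j assume "(i, j) \<in> arcs Cr ^^ l"
    \<comment> \<open>The first arc of the walk places \<open>i\<close> in a component.\<close>
    then obtain k where "(i, k) \<in> arcs Cr" using l(1) by (metis gr0_conv_Suc relpow_Suc_D2)
    then obtain H where "H \<in> pre_digraph.sccs Cr" "i \<in> verts H" using arc_in_scc[OF cov] by metis
    then show "(arcs Cr ^^ l) `` {i} \<in> (\<Union>H\<in>pre_digraph.sccs Cr. ?F H)" by blast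
  qed
  also have "\<dots> \<le> (\<Sum>H\<in>pre_digraph.sccs Cr. card (?F H))" by (rule card_UN_le[OF finS])
  also have "\<dots> \<le> (\<Sum>H\<in>pre_digraph.sccs Cr. sc_cyclicity H)" by (rule sum_mono) (rule F(2))
  finally show ?thesis .
qed

theorem theorem3p10:
  fixes n k :: nat
    and X Y :: "rmax mat set"
    and D Cr :: digraph
    and A :: "nat \<Rightarrow> rmax mat"
  assumes X_nonempty: "X \<noteq> {}"
    and X_square: "X \<subseteq> carrier_mat n n"
    and X_irreducible: "\<forall>M\<in>X. irreducible_mat M"
    and X_finite_mean: "\<forall>M\<in>X. \<bar>max_cycle_mean M\<bar> \<noteq> \<infinity>"
    and Y_eq: "Y = normalized ` X"
    and sup_finite: "sup_in_rmax n Y"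
    and digraph: "\<forall>M\<in>X. mat_digraph M = D"
    and sup_digraph: "mat_digraph (sup_mat n Y) = D"
    and critical: "\<forall>M\<in>X. critical_digraph M = Cr"
    and sup_critical: "critical_digraph (sup_mat n Y) = Cr"
    and inf_finite: "\<forall>(i, j)\<in>arcs D. rval (inf_mat n Y $$ (i, j)) \<noteq> -\<infinity>"
    and zero_on_critical: "\<forall>M\<in>Y. \<forall>(i, j)\<in>arcs Cr.
          rval (M $$ (i, j)) = 0 \<and> rval (sup_mat n Y $$ (i, j)) = 0"
    and nonpos_off_critical: "\<forall>M\<in>Y. \<forall>i<n. \<forall>j<n. (i, j) \<notin> arcs Cr \<longrightarrow>
          rval (M $$ (i, j)) \<le> 0 \<and> rval (sup_mat n Y $$ (i, j)) \<le> 0"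
    and k_pos: "k \<ge> 1"
    and A_in_Y: "\<forall>s\<in>{1..k}. A s \<in> Y"
  shows "(\<forall>H \<in> pre_digraph.sccs Cr. \<forall>t.
            t * sc_cyclicity H \<ge> transient (support_mat n H) (sc_cyclicity H) \<longrightarrow>
            factor_rank (CSR n H (sc_cyclicity H) t k (mat_product n A k)) \<le> sc_cyclicity H) \<and>
         (\<forall>t. t * cyclicity Cr \<ge> transient (support_mat n Cr) (cyclicity Cr) \<longrightarrow>
            factor_rank (CSR n Cr (cyclicity Cr) t k (mat_product n A k))
              \<le> (\<Sum>H \<in> pre_digraph.sccs Cr. sc_cyclicity H))"
proof (intro conjI ballI allI impI)
  \<comment> \<open>Any member of \<open>X\<close> exhibits \<open>Cr\<close> as the critical
    digraph of an actual matrix, whence its cover by cycles and its index bounds.\<close>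
  obtain M where M: "M \<in> X" using X_nonempty by blast
  then have Cr: "critical_digraph M = Cr" "M \<in> carrier_mat n n" using critical X_square by auto
  have cov: "covered_by_cycles Cr"
    using critical_digraph_covered_by_cycles[of M] Cr(1) by simp
  note bounds = critical_digraph_bounds[OF Cr(2), unfolded Cr(1)]
  have "Y \<subseteq> carrier_mat n n" using X_square by (auto simp: Y_eq normalized_def)
  then have G: "mat_product n A k \<in> carrier_mat n n"
    using A_in_Y by (intro mat_product_carrier) auto
  show "factor_rank (CSR n H (sc_cyclicity H) t k (mat_product n A k)) \<le> sc_cyclicity H"
    if "H \<in> pre_digraph.sccs Cr"
      and "transient (support_mat n H) (sc_cyclicity H) \<le> t * sc_cyclicity H" for H t
    using factor_rank_CSR_scc_le[OF cov bounds(2) G that] .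
  show "factor_rank (CSR n Cr (cyclicity Cr) t k (mat_product n A k))
      \<le> (\<Sum>H \<in> pre_digraph.sccs Cr. sc_cyclicity H)"
    if "transient (support_mat n Cr) (cyclicity Cr) \<le> t * cyclicity Cr" for t
    using factor_rank_CSR_le[OF cov bounds(2) finite_subset[OF bounds(1)] G that] by simp
qed

end
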